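(* Let $(M,\langle\cdot,\cdot\rangle,J)$ be an almost Hermitian $2n$-manifold with Kähler form $\omega$ and intrinsic torsion $\xi$. The following conditions are equivalent: (i) The almost Hermitian structure is harmonic. (ii) $[J,\nabla^*\nabla J]=0$, where $[\cdot,\cdot]$ is the commutator bracket of endomorphisms. (iii) $\nabla^*\nabla\omega$ is a Hermitian two-form. (iv) $\nabla^*\nabla\omega(X,Y)=-4\sum_i\omega(\xi_{e_i}X,\xi_{e_i}Y)$ for all $X,Y\in\mathfrak X(M)$, where $\{e_i\}$ is a local orthonormal frame.
   Context: An almost Hermitian $2n$-manifold is a $2n$-dimensional Riemannian manifold with an almost complex structure $J$ ($J^2=-\mathrm{Id}$) satisfying $\langle JX,JY\rangle=\langle X,Y\rangle$; equivalently a manifold with a $U(n)$-structure. The Kähler form is $\omega(X,Y)=\langle X,JY\rangle$. $\nabla$ is the Levi-Civita connection. The intrinsic torsion is $\xi_XY=-\frac12J(\nabla_XJ)Y$; each $\xi_X$ is a skew-symmetric endomorphism anticommuting with $J$, and $\nabla^{U(n)}=\nabla+\xi$ is the minimal $U(n)$-connection. The almost Hermitian structure is called harmonic if $d^*\xi:=-\sum_i(\nabla_{e_i}\xi)_{e_i}=0$. A two-form $b$ is Hermitian if $b(JX,JY)=b(X,Y)$. The connection (rough) Laplacian of a tensor field $\Psi$ is $\nabla^*\nabla\Psi=-\sum_i(\nabla^2\Psi)_{e_i,e_i}$, where $(\nabla^2\Psi)_{X,Y}=\nabla_X(\nabla_Y\Psi)-\nabla_{\nabla_XY}\Psi$. 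*)

theory Defs
  imports "HOL-Analysis.Analysis" "HOL-Library.Function_Algebras"
begin

text \<open>
  The manifold is the whole of a Hausdorff second countable type \<open>'m\<close> with a smooth atlas modelled on
  a Euclidean space \<open>'e\<close>. Smooth vector fields are the derivations of the ring of smooth functions, and
  tensor fields are maps that are multilinear over that ring. Sums, differences and products of
  functions (and of derivations) are the pointwise ones of \<^theory>\<open>HOL-Library.Function_Algebras\<close>.
\<close>

section \<open>Smooth manifolds\<close>

text \<open>Only used for open \<open>S\<close>.\<close>

primrec Ck_on :: "nat \<Rightarrow> 'a::real_normed_vector set \<Rightarrow> ('a \<Rightarrow> 'b::real_normed_vector) \<Rightarrow> bool" where
  "Ck_on 0 S f \<longleftrightarrow> continuous_on S f"
| "Ck_on (Suc k) S f \<longleftrightarrow>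
     (\<forall>x\<in>S. f differentiable (at x)) \<and> (\<forall>v. Ck_on k S (\<lambda>x. frechet_derivative f (at x) v))"

definition smooth_on :: "'a::real_normed_vector set \<Rightarrow> ('a \<Rightarrow> 'b::real_normed_vector) \<Rightarrow> bool" where
  "smooth_on S f \<longleftrightarrow> (\<forall>k. Ck_on k S f)"

text \<open>A chart is a pair \<open>(U, \<phi>)\<close>; the values of \<open>\<phi>\<close> outside \<open>U\<close> are irrelevant.\<close>

type_synonym ('m, 'e) chart = "'m set \<times> ('m \<Rightarrow> 'e)"

definition is_chart :: "('m::topological_space, 'e::euclidean_space) chart \<Rightarrow> bool" where
  "is_chart = (\<lambda>(U, \<phi>). open U \<and> open (\<phi> ` U) \<and> homeomorphism U (\<phi> ` U) \<phi> (inv_into U \<phi>))"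

definition smooth_atlas ::
  "('m::{t2_space, second_countable_topology}, 'e::euclidean_space) chart set \<Rightarrow> bool" where
  "smooth_atlas A \<longleftrightarrow>
     (\<forall>c\<in>A. is_chart c) \<and> (\<Union>(U, \<phi>)\<in>A. U) = UNIV \<and>
     (\<forall>(U, \<phi>)\<in>A. \<forall>(V, \<psi>)\<in>A. smooth_on (\<phi> ` (U \<inter> V)) (\<psi> \<circ> inv_into U \<phi>))"

definition smooth_functions ::
  "('m::topological_space, 'e::euclidean_space) chart set \<Rightarrow> ('m \<Rightarrow> real) set" where
  "smooth_functions A = {f. \<forall>(U, \<phi>)\<in>A. smooth_on (\<phi> ` U) (f \<circ> inv_into U \<phi>)}"

text \<open>
  A vector field acts on functions. The value zero on non-smooth functions is a normalisation that
  makes equality of vector fields the equality of HOL functions.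
\<close>

type_synonym 'm vfield = "('m \<Rightarrow> real) \<Rightarrow> 'm \<Rightarrow> real"

definition vector_fields ::
  "('m::topological_space, 'e::euclidean_space) chart set \<Rightarrow> 'm vfield set" where
  "vector_fields A = {X.
     (\<forall>f\<in>smooth_functions A. X f \<in> smooth_functions A) \<and>
     (\<forall>f. f \<notin> smooth_functions A \<longrightarrow> X f = 0) \<and>
     (\<forall>f\<in>smooth_functions A. \<forall>h\<in>smooth_functions A. X (f + h) = X f + X h) \<and>
     (\<forall>c. \<forall>f\<in>smooth_functions A. X (\<lambda>p. c * f p) = (\<lambda>p. c * X f p)) \<and>
     (\<forall>f\<in>smooth_functions A. \<forall>h\<in>smooth_functions A. X (f * h) = f * X h + h * X f)}"

definition fmult :: "('m \<Rightarrow> real) \<Rightarrow> 'm vfield \<Rightarrow> 'm vfield" where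
  "fmult f X = (\<lambda>h. f * X h)"

definition bracket :: "'m vfield \<Rightarrow> 'm vfield \<Rightarrow> 'm vfield" where
  "bracket X Y = (\<lambda>f. X (Y f) - Y (X f))"

definition vanishes_at ::
  "('m::topological_space, 'e::euclidean_space) chart set \<Rightarrow> 'm vfield \<Rightarrow> 'm \<Rightarrow> bool" where
  "vanishes_at A X p \<longleftrightarrow> (\<forall>f\<in>smooth_functions A. X f p = 0)"

section \<open>Almost Hermitian structures and the Levi-Civita connection\<close>

definition riemannian_metric ::
  "('m::topological_space, 'e::euclidean_space) chart set
     \<Rightarrow> ('m vfield \<Rightarrow> 'm vfield \<Rightarrow> 'm \<Rightarrow> real) \<Rightarrow> bool" where
  "riemannian_metric A g \<longleftrightarrow>
     (\<forall>X\<in>vector_fields A. \<forall>Y\<in>vector_fields A. g X Y \<in> smooth_functions A \<and> g X Y = g Y X) \<and>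
     (\<forall>X\<in>vector_fields A. \<forall>Y\<in>vector_fields A. \<forall>Z\<in>vector_fields A. g (X + Y) Z = g X Z + g Y Z) \<and>
     (\<forall>f\<in>smooth_functions A. \<forall>X\<in>vector_fields A. \<forall>Y\<in>vector_fields A. g (fmult f X) Y = f * g X Y) \<and>
     (\<forall>X\<in>vector_fields A. \<forall>p. 0 \<le> g X X p \<and> (g X X p = 0 \<longleftrightarrow> vanishes_at A X p))"

definition almost_complex_structure ::
  "('m::topological_space, 'e::euclidean_space) chart set \<Rightarrow> ('m vfield \<Rightarrow> 'm vfield) \<Rightarrow> bool" where
  "almost_complex_structure A J \<longleftrightarrow>
     (\<forall>X\<in>vector_fields A. J X \<in> vector_fields A \<and> J (J X) = - X) \<and>
     (\<forall>X\<in>vector_fields A. \<forall>Y\<in>vector_fields A. J (X + Y) = J X + J Y) \<and>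
     (\<forall>f\<in>smooth_functions A. \<forall>X\<in>vector_fields A. J (fmult f X) = fmult f (J X))"

definition almost_hermitian_manifold ::
  "nat \<Rightarrow> ('m::{t2_space, second_countable_topology}, 'e::euclidean_space) chart set
     \<Rightarrow> ('m vfield \<Rightarrow> 'm vfield \<Rightarrow> 'm \<Rightarrow> real) \<Rightarrow> ('m vfield \<Rightarrow> 'm vfield) \<Rightarrow> bool" where
  "almost_hermitian_manifold n A g J \<longleftrightarrow>
     smooth_atlas A \<and> DIM('e) = 2 * n \<and> riemannian_metric A g \<and> almost_complex_structure A J \<and>
     (\<forall>X\<in>vector_fields A. \<forall>Y\<in>vector_fields A. g (J X) (J Y) = g X Y)"

text \<open>\<open>D X Y\<close> stands for \<open>\<nabla>\<^sub>X Y\<close>; the last two clauses say metric and torsion-free.\<close>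

definition levi_civita_connection ::
  "('m::topological_space, 'e::euclidean_space) chart set
     \<Rightarrow> ('m vfield \<Rightarrow> 'm vfield \<Rightarrow> 'm \<Rightarrow> real)
     \<Rightarrow> ('m vfield \<Rightarrow> 'm vfield \<Rightarrow> 'm vfield) \<Rightarrow> bool" where
  "levi_civita_connection A g D \<longleftrightarrow>
     (\<forall>X\<in>vector_fields A. \<forall>Y\<in>vector_fields A. D X Y \<in> vector_fields A) \<and>
     (\<forall>X\<in>vector_fields A. \<forall>Y\<in>vector_fields A. \<forall>Z\<in>vector_fields A.
        D (X + Y) Z = D X Z + D Y Z \<and> D X (Y + Z) = D X Y + D X Z) \<and>
     (\<forall>f\<in>smooth_functions A. \<forall>X\<in>vector_fields A. \<forall>Y\<in>vector_fields A.
        D (fmult f X) Y = fmult f (D X Y) \<and> D X (fmult f Y) = fmult (X f) Y + fmult f (D X Y)) \<and>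
     (\<forall>X\<in>vector_fields A. \<forall>Y\<in>vector_fields A. \<forall>Z\<in>vector_fields A.
        X (g Y Z) = g (D X Y) Z + g Y (D X Z)) \<and>
     (\<forall>X\<in>vector_fields A. \<forall>Y\<in>vector_fields A. D X Y - D Y X = bracket X Y)"

definition kahler_form ::
  "('m vfield \<Rightarrow> 'm vfield \<Rightarrow> 'm \<Rightarrow> real) \<Rightarrow> ('m vfield \<Rightarrow> 'm vfield)
     \<Rightarrow> 'm vfield \<Rightarrow> 'm vfield \<Rightarrow> 'm \<Rightarrow> real" where
  "kahler_form g J X Y = g X (J Y)"

section \<open>Covariant derivatives of tensor fields\<close>

text \<open>
  \<open>cov_endo D T X Z\<close> is \<open>(\<nabla>\<^sub>X T) Z\<close> for a field of endomorphisms \<open>T\<close>,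
  \<open>cov_form D b X Y Z\<close> is \<open>(\<nabla>\<^sub>X b)(Y, Z)\<close> for a two-form \<open>b\<close>, and
  \<open>cov_endo_form D \<eta> X Y Z\<close> is \<open>(\<nabla>\<^sub>X \<eta>)\<^sub>Y Z\<close> for an endomorphism-valued one-form \<open>\<eta>\<close>.
\<close>

definition cov_endo ::
  "('m vfield \<Rightarrow> 'm vfield \<Rightarrow> 'm vfield) \<Rightarrow> ('m vfield \<Rightarrow> 'm vfield)
     \<Rightarrow> 'm vfield \<Rightarrow> 'm vfield \<Rightarrow> 'm vfield" where
  "cov_endo D T X Z = D X (T Z) - T (D X Z)"

definition cov_form ::
  "('m vfield \<Rightarrow> 'm vfield \<Rightarrow> 'm vfield) \<Rightarrow> ('m vfield \<Rightarrow> 'm vfield \<Rightarrow> 'm \<Rightarrow> real)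
     \<Rightarrow> 'm vfield \<Rightarrow> 'm vfield \<Rightarrow> 'm vfield \<Rightarrow> 'm \<Rightarrow> real" where
  "cov_form D b X Y Z = X (b Y Z) - b (D X Y) Z - b Y (D X Z)"

definition cov_endo_form ::
  "('m vfield \<Rightarrow> 'm vfield \<Rightarrow> 'm vfield) \<Rightarrow> ('m vfield \<Rightarrow> 'm vfield \<Rightarrow> 'm vfield)
     \<Rightarrow> 'm vfield \<Rightarrow> 'm vfield \<Rightarrow> 'm vfield \<Rightarrow> 'm vfield" where
  "cov_endo_form D \<eta> X Y Z = D X (\<eta> Y Z) - \<eta> (D X Y) Z - \<eta> Y (D X Z)"

text \<open>The second covariant derivatives \<open>(\<nabla>\<^sup>2\<Psi>)\<^sub>X\<^sub>,\<^sub>Y = \<nabla>\<^sub>X(\<nabla>\<^sub>Y \<Psi>) - \<nabla>\<^bsub>\<nabla>\<^sub>X Y\<^esub> \<Psi>\<close>.\<close>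

definition cov2_endo ::
  "('m vfield \<Rightarrow> 'm vfield \<Rightarrow> 'm vfield) \<Rightarrow> ('m vfield \<Rightarrow> 'm vfield)
     \<Rightarrow> 'm vfield \<Rightarrow> 'm vfield \<Rightarrow> 'm vfield \<Rightarrow> 'm vfield" where
  "cov2_endo D T X Y Z = cov_endo D (cov_endo D T Y) X Z - cov_endo D T (D X Y) Z"

definition cov2_form ::
  "('m vfield \<Rightarrow> 'm vfield \<Rightarrow> 'm vfield) \<Rightarrow> ('m vfield \<Rightarrow> 'm vfield \<Rightarrow> 'm \<Rightarrow> real)
     \<Rightarrow> 'm vfield \<Rightarrow> 'm vfield \<Rightarrow> 'm vfield \<Rightarrow> 'm vfield \<Rightarrow> 'm \<Rightarrow> real" where
  "cov2_form D b X Y Z W = cov_form D (cov_form D b Y) X Z W - cov_form D b (D X Y) Z W"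

definition intrinsic_torsion ::
  "('m vfield \<Rightarrow> 'm vfield \<Rightarrow> 'm vfield) \<Rightarrow> ('m vfield \<Rightarrow> 'm vfield)
     \<Rightarrow> 'm vfield \<Rightarrow> 'm vfield \<Rightarrow> 'm vfield" where
  "intrinsic_torsion D J X Y = fmult (\<lambda>_. - 1 / 2) (J (cov_endo D J X Y))"

section \<open>Local orthonormal frames and traces\<close>

text \<open>
  The members \<open>E i\<close>, \<open>i < DIM('e)\<close>, of a local frame are globally defined fields that are orthonormal
  on the open set \<open>U\<close>. This is no restriction: by means of cut-off functions every local orthonormal
  frame coincides, near each point of its domain, with a frame of this kind.
\<close>

definition local_orthonormal_frame ::
  "('m::topological_space, 'e::euclidean_space) chart set
     \<Rightarrow> ('m vfield \<Rightarrow> 'm vfield \<Rightarrow> 'm \<Rightarrow> real) \<Rightarrow> 'm set \<Rightarrow> (nat \<Rightarrow> 'm vfield) \<Rightarrow> bool" where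
  "local_orthonormal_frame A g U E \<longleftrightarrow>
     open U \<and> (\<forall>i<DIM('e). E i \<in> vector_fields A) \<and>
     (\<forall>p\<in>U. \<forall>i<DIM('e). \<forall>j<DIM('e). g (E i) (E j) p = (if i = j then 1 else 0))"

text \<open>
  The following traces over the fields \<open>E i\<close>, \<open>i < m\<close>, are the codifferential and the rough Laplacians
  on \<open>U\<close> whenever \<open>E\<close> is a local orthonormal frame on \<open>U\<close> (and \<open>m\<close> is the dimension). On \<open>U\<close> they do not
  depend on the frame, so a property of the globally defined tensor field is expressed by
  demanding it on \<open>U\<close> for all local orthonormal frames.
\<close>

definition codiff ::
  "nat \<Rightarrow> (nat \<Rightarrow> 'm vfield) \<Rightarrow> ('m vfield \<Rightarrow> 'm vfield \<Rightarrow> 'm vfield)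
     \<Rightarrow> ('m vfield \<Rightarrow> 'm vfield \<Rightarrow> 'm vfield) \<Rightarrow> 'm vfield \<Rightarrow> 'm vfield" where
  "codiff m E D \<eta> Z = - (\<Sum>i<m. cov_endo_form D \<eta> (E i) (E i) Z)"

definition rough_laplacian_endo ::
  "nat \<Rightarrow> (nat \<Rightarrow> 'm vfield) \<Rightarrow> ('m vfield \<Rightarrow> 'm vfield \<Rightarrow> 'm vfield)
     \<Rightarrow> ('m vfield \<Rightarrow> 'm vfield) \<Rightarrow> 'm vfield \<Rightarrow> 'm vfield" where
  "rough_laplacian_endo m E D T Z = - (\<Sum>i<m. cov2_endo D T (E i) (E i) Z)"

definition rough_laplacian_form ::
  "nat \<Rightarrow> (nat \<Rightarrow> 'm vfield) \<Rightarrow> ('m vfield \<Rightarrow> 'm vfield \<Rightarrow> 'm vfield)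
     \<Rightarrow> ('m vfield \<Rightarrow> 'm vfield \<Rightarrow> 'm \<Rightarrow> real) \<Rightarrow> 'm vfield \<Rightarrow> 'm vfield \<Rightarrow> 'm \<Rightarrow> real" where
  "rough_laplacian_form m E D b Z W = - (\<Sum>i<m. cov2_form D b (E i) (E i) Z W)"

definition commutator :: "('m vfield \<Rightarrow> 'm vfield) \<Rightarrow> ('m vfield \<Rightarrow> 'm vfield) \<Rightarrow> 'm vfield \<Rightarrow> 'm vfield" where
  "commutator S T X = S (T X) - T (S X)"

definition hermitian_form_on ::
  "('m::topological_space, 'e::euclidean_space) chart set \<Rightarrow> ('m vfield \<Rightarrow> 'm vfield) \<Rightarrow> 'm set
     \<Rightarrow> ('m vfield \<Rightarrow> 'm vfield \<Rightarrow> 'm \<Rightarrow> real) \<Rightarrow> bool" where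
  "hermitian_form_on A J U b \<longleftrightarrow>
     (\<forall>X\<in>vector_fields A. \<forall>Y\<in>vector_fields A. \<forall>p\<in>U. b (J X) (J Y) p = b X Y p)"

definition harmonic_almost_hermitian ::
  "nat \<Rightarrow> ('m::topological_space, 'e::euclidean_space) chart set
     \<Rightarrow> ('m vfield \<Rightarrow> 'm vfield \<Rightarrow> 'm \<Rightarrow> real) \<Rightarrow> ('m vfield \<Rightarrow> 'm vfield)
     \<Rightarrow> ('m vfield \<Rightarrow> 'm vfield \<Rightarrow> 'm vfield) \<Rightarrow> bool" where
  "harmonic_almost_hermitian n A g J D \<longleftrightarrow>
     (\<forall>U E. local_orthonormal_frame A g U E \<longrightarrow>
        (\<forall>Z\<in>vector_fields A. \<forall>p\<in>U. vanishes_at A (codiff (2 * n) E D (intrinsic_torsion D J) Z) p))"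

end

theory Submission
  imports Defs
begin

text \<open>
  Put \<open>N\<^sub>i = \<nabla>\<^bsub>e\<^sub>i\<^esub> J\<close> and \<open>L = \<nabla>\<^sup>*\<nabla>J\<close>. Differentiating \<open>J\<^sup>2 = -1\<close> twice and tracing gives
  \<open>L J + J L = 2 \<Sum> N\<^sub>i\<^sup>2\<close>; since \<open>2 \<nabla>\<xi> = - (\<nabla>J \<nabla>J + J \<nabla>\<^sup>2J)\<close>, it follows that
  \<open>d\<^sup>*\<xi> = - 1/4 [J, L]\<close>. As \<open>\<nabla>g = 0\<close>, we have \<open>\<nabla>\<^sup>*\<nabla>\<omega>(X, Y) = g(X, L Y)\<close>, and both the failure of
  this form to be Hermitian and the difference of the two sides of (iv) are nonzero multiples
  of \<open>g(J X, [J, L] Y)\<close>.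
\<close>

section \<open>Calculus of \<open>Ck_on\<close> on open sets\<close>

lemma Ck_on_cong:
  assumes "open S" "\<And>x. x \<in> S \<Longrightarrow> f x = h x" "Ck_on k S f"
  shows "Ck_on k S h"
  using assms(2,3)
proof (induction k arbitrary: f h)
  case 0
  then show ?case using continuous_on_cong[of S S f h] by simp
next
  case (Suc k)
  have "h differentiable (at x)"
    and "frechet_derivative f (at x) v = frechet_derivative h (at x) v" if "x \<in> S" for x v
  proof -
    have d: "(f has_derivative frechet_derivative f (at x)) (at x)"
      using Suc.prems(2) that frechet_derivative_works by auto
    \<comment> \<open>Openness of \<open>S\<close> turns agreement on \<open>S\<close> into
      agreement near \<open>x\<close>, which is what a derivative at \<open>x\<close> sees.\<close>
    have "(h has_derivative frechet_derivative f (at x)) (at x)"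
      using has_derivative_transform_within_open[OF d assms(1) that] Suc.prems(1) by blast
    then show "h differentiable (at x)"
      and "frechet_derivative f (at x) v = frechet_derivative h (at x) v"
      using frechet_derivative_at differentiableI by metis+
  qed
  moreover have "Ck_on k S (\<lambda>x. frechet_derivative h (at x) v)" for v
    by (rule Suc.IH[of "\<lambda>x. frechet_derivative f (at x) v"]) (use calculation Suc.prems(2) in auto)
  ultimately show ?case by simp
qed

lemma Ck_on_Suc_imp_Ck_on: "Ck_on (Suc k) S f \<Longrightarrow> Ck_on k S f"
proof (induction k arbitrary: f)
  case 0
  then show ?case
    by (auto intro!: continuous_at_imp_continuous_on differentiable_imp_continuous_within)
next
  case (Suc k)
  then show ?case by (metis Ck_on.simps(2))
qed

lemma Ck_on_const: "Ck_on k S (\<lambda>_. c)"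
  by (induction k arbitrary: c) auto

text \<open>The sum rule describes the derivative only at points of \<open>S\<close>, so
  \<open>Ck_on_cong\<close> carries regularity over to \<open>frechet_derivative\<close> of the
  sum.\<close>

lemma Ck_on_add:
  assumes "open S" "Ck_on k S f" "Ck_on k S h"
  shows "Ck_on k S (\<lambda>x. f x + h x)"
  using assms(2,3)
proof (induction k arbitrary: f h)
  case 0
  then show ?case by (simp add: continuous_on_add)
next
  case (Suc k)
  have "Ck_on k S (\<lambda>x. frechet_derivative (\<lambda>x. f x + h x) (at x) v)" for v
  proof (rule Ck_on_cong[OF assms(1)])
    show "Ck_on k S (\<lambda>x. frechet_derivative f (at x) v + frechet_derivative h (at x) v)"
      using Suc by simp
    show "frechet_derivative f (at x) v + frechet_derivative h (at x) v
        = frechet_derivative (\<lambda>x. f x + h x) (at x) v" if "x \<in> S" for x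
      using Suc.prems that
      by (intro has_derivative_add[THEN frechet_derivative_at, THEN fun_cong])
        (simp_all add: frechet_derivative_works[symmetric])
  qed
  then show ?case using Suc.prems by simp
qed

lemma Ck_on_mult:
  fixes f h :: "'a::real_normed_vector \<Rightarrow> 'b::real_normed_algebra"
  assumes "open S" "Ck_on k S f" "Ck_on k S h"
  shows "Ck_on k S (\<lambda>x. f x * h x)"
  using assms(2,3)
proof (induction k arbitrary: f h)
  case 0
  then show ?case by (simp add: continuous_on_mult)
next
  case (Suc k)
  \<comment> \<open>The Leibniz formula contains the undifferentiated factors, which the induction
    hypothesis needs at order \<open>k\<close> rather than \<open>Suc k\<close>.\<close>
  have low: "Ck_on k S f" "Ck_on k S h"
    using Suc.prems Ck_on_Suc_imp_Ck_on by blast+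
  have D: "((\<lambda>x. f x * h x) has_derivative
      (\<lambda>v. f x * frechet_derivative h (at x) v + frechet_derivative f (at x) v * h x)) (at x)"
    if "x \<in> S" for x
    using Suc.prems that by (intro has_derivative_mult) (simp_all add: frechet_derivative_works[symmetric])
  have "Ck_on k S (\<lambda>x. frechet_derivative (\<lambda>x. f x * h x) (at x) v)" for v
  proof (rule Ck_on_cong[OF assms(1)])
    show "Ck_on k S (\<lambda>x. f x * frechet_derivative h (at x) v + frechet_derivative f (at x) v * h x)"
      using Suc.prems low by (intro Ck_on_add[OF assms(1)] Suc.IH) simp_all
    show "f x * frechet_derivative h (at x) v + frechet_derivative f (at x) v * h x
        = frechet_derivative (\<lambda>x. f x * h x) (at x) v" if "x \<in> S" for x
      using frechet_derivative_at[OF D[OF that]] by metis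
  qed
  then show ?case using D differentiableI by (metis Ck_on.simps(2))
qed

lemma sum_fun_apply: "(\<Sum>i\<in>I. f i) x = (\<Sum>i\<in>I. f i x)"
  by (induction I rule: infinite_finite_induct) auto

section \<open>Smooth functions and the module of vector fields\<close>

locale almost_hermitian =
  fixes A :: "('m::{t2_space, second_countable_topology}, 'e::euclidean_space) chart set"
    and n :: nat
    and g :: "'m vfield \<Rightarrow> 'm vfield \<Rightarrow> 'm \<Rightarrow> real"
    and J :: "'m vfield \<Rightarrow> 'm vfield"
    and D :: "'m vfield \<Rightarrow> 'm vfield \<Rightarrow> 'm vfield"
  assumes hermitian: "almost_hermitian_manifold n A g J"
    and levi_civita: "levi_civita_connection A g D"
begin

abbreviation "\<F> \<equiv> smooth_functions A"
abbreviation "\<X> \<equiv> vector_fields A"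

lemma atlas_open: "(U, \<phi>) \<in> A \<Longrightarrow> open (\<phi> ` U)"
  using hermitian unfolding almost_hermitian_manifold_def smooth_atlas_def is_chart_def by fastforce

lemma smooth_const: "(\<lambda>_. c) \<in> \<F>"
  unfolding smooth_functions_def smooth_on_def by (auto simp: comp_def Ck_on_const)

lemma smooth_add: "f \<in> \<F> \<Longrightarrow> h \<in> \<F> \<Longrightarrow> f + h \<in> \<F>"
  unfolding smooth_functions_def smooth_on_def
  by (auto simp: comp_def dest!: bspec intro!: Ck_on_add atlas_open)

lemma smooth_mult: "f \<in> \<F> \<Longrightarrow> h \<in> \<F> \<Longrightarrow> f * h \<in> \<F>"
  unfolding smooth_functions_def smooth_on_def
  by (auto simp: comp_def dest!: bspec intro!: Ck_on_mult atlas_open)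

lemma vf_apply_add: "X \<in> \<X> \<Longrightarrow> f \<in> \<F> \<Longrightarrow> h \<in> \<F> \<Longrightarrow> X (f + h) = X f + X h"
  by (simp add: vector_fields_def)

text \<open>The Leibniz rule for 1 = 1 * 1 gives X 1 = 2 X 1, hence X 1 = 0; homogeneity then covers
  every constant.\<close>

lemma vf_const:
  assumes "X \<in> \<X>"
  shows "X (\<lambda>_. c) = 0"
proof -
  have "X ((\<lambda>_. 1) * (\<lambda>_. 1)) = (\<lambda>_. 1) * X (\<lambda>_. 1) + (\<lambda>_. 1) * X (\<lambda>_. 1)"
    using assms smooth_const unfolding vector_fields_def by blast
  then have 1: "X (\<lambda>_. 1) = 0"
    by (auto simp: fun_eq_iff times_fun_def)
  have "X (\<lambda>p. c * f p) = (\<lambda>p. c * X f p)" if "f \<in> \<F>" for f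
    using assms that by (simp add: vector_fields_def)
  from this[OF smooth_const[of 1]] show ?thesis
    by (simp add: 1 fun_eq_iff)
qed

lemma vf_add [simp]:
  assumes "X \<in> \<X>" "Y \<in> \<X>"
  shows "X + Y \<in> \<X>"
  using assms unfolding vector_fields_def
  by (auto simp: smooth_add fun_eq_iff algebra_simps)

lemma vf_fmult [simp]:
  assumes "f \<in> \<F>" "X \<in> \<X>"
  shows "fmult f X \<in> \<X>"
  using assms unfolding vector_fields_def fmult_def
  by (auto simp: smooth_mult fun_eq_iff algebra_simps)

lemma vf_zero [simp]: "0 \<in> \<X>"
  using smooth_const[of 0] by (auto simp: vector_fields_def fun_eq_iff zero_fun_def)

lemma vf_uminus [simp]:
  assumes "X \<in> \<X>"
  shows "- X \<in> \<X>"
proof -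
  have "- X = fmult (\<lambda>_. - 1) X"
    by (simp add: fmult_def fun_eq_iff)
  then show ?thesis using assms smooth_const by (metis vf_fmult)
qed

lemma vf_diff [simp]:
  assumes "X \<in> \<X>" "Y \<in> \<X>"
  shows "X - Y \<in> \<X>"
  using vf_add[OF assms(1) vf_uminus[OF assms(2)]] by simp

lemma vf_sum [simp]: "(\<And>i. i \<in> I \<Longrightarrow> V i \<in> \<X>) \<Longrightarrow> (\<Sum>i\<in>I. V i) \<in> \<X>"
  by (induction I rule: infinite_finite_induct) auto


text \<open>\<open>J\<close>, \<open>D X\<close> and \<open>g X\<close> are known to be additive
  only on \<open>\<X>\<close>, not on the whole type. The usual consequences are derived here once,
  for values in any abelian group.\<close>

lemma additive_vf:
  fixes T :: "'m vfield \<Rightarrow> 'b::ab_group_add"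
  assumes add: "\<And>X Y. X \<in> \<X> \<Longrightarrow> Y \<in> \<X> \<Longrightarrow> T (X + Y) = T X + T Y"
  shows "T 0 = 0"
    and "X \<in> \<X> \<Longrightarrow> T (- X) = - T X"
    and "X \<in> \<X> \<Longrightarrow> Y \<in> \<X> \<Longrightarrow> T (X - Y) = T X - T Y"
    and "(\<And>i. i \<in> I \<Longrightarrow> V i \<in> \<X>) \<Longrightarrow> T (\<Sum>i\<in>I. V i) = (\<Sum>i\<in>I. T (V i))"
proof -
  show zero: "T 0 = 0"
    using add[of 0 0] by simp
  show minus: "T (- X) = - T X" if "X \<in> \<X>" for X
    using add[of X "- X"] that zero by (simp add: eq_neg_iff_add_eq_0 add.commute)
  show "T (X - Y) = T X - T Y" if "X \<in> \<X>" "Y \<in> \<X>"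
    using add[of X "- Y"] that minus by simp
  show "T (\<Sum>i\<in>I. V i) = (\<Sum>i\<in>I. T (V i))" if "\<And>i. i \<in> I \<Longrightarrow> V i \<in> \<X>"
    using that by (induction I rule: infinite_finite_induct) (auto simp: zero add)
qed

section \<open>Algebra of the almost complex structure, the connection and the metric\<close>

lemma J_vf [simp]: "X \<in> \<X> \<Longrightarrow> J X \<in> \<X>"
  and J_J [simp]: "X \<in> \<X> \<Longrightarrow> J (J X) = - X"
  and J_add: "X \<in> \<X> \<Longrightarrow> Y \<in> \<X> \<Longrightarrow> J (X + Y) = J X + J Y"
  and J_fmult: "f \<in> \<F> \<Longrightarrow> X \<in> \<X> \<Longrightarrow> J (fmult f X) = fmult f (J X)"
  and g_J_J: "X \<in> \<X> \<Longrightarrow> Y \<in> \<X> \<Longrightarrow> g (J X) (J Y) = g X Y"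
  using hermitian unfolding almost_hermitian_manifold_def almost_complex_structure_def by blast+

lemma J_uminus: "X \<in> \<X> \<Longrightarrow> J (- X) = - J X"
  and J_diff: "X \<in> \<X> \<Longrightarrow> Y \<in> \<X> \<Longrightarrow> J (X - Y) = J X - J Y"
  and J_sum: "(\<And>i. i \<in> I \<Longrightarrow> V i \<in> \<X>) \<Longrightarrow> J (\<Sum>i\<in>I. V i) = (\<Sum>i\<in>I. J (V i))"
  by (simp_all add: additive_vf(2-4)[of J] J_add)

lemma D_vf [simp]: "X \<in> \<X> \<Longrightarrow> Y \<in> \<X> \<Longrightarrow> D X Y \<in> \<X>"
  and D_add: "X \<in> \<X> \<Longrightarrow> Y \<in> \<X> \<Longrightarrow> Z \<in> \<X> \<Longrightarrow> D X (Y + Z) = D X Y + D X Z"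
  and D_fmult: "f \<in> \<F> \<Longrightarrow> X \<in> \<X> \<Longrightarrow> Y \<in> \<X> \<Longrightarrow>
        D X (fmult f Y) = fmult (X f) Y + fmult f (D X Y)"
  and D_metric: "X \<in> \<X> \<Longrightarrow> Y \<in> \<X> \<Longrightarrow> Z \<in> \<X> \<Longrightarrow>
        X (g Y Z) = g (D X Y) Z + g Y (D X Z)"
  using levi_civita unfolding levi_civita_connection_def by blast+

lemma D_uminus: "X \<in> \<X> \<Longrightarrow> Y \<in> \<X> \<Longrightarrow> D X (- Y) = - D X Y"
  by (simp add: additive_vf(2)[of "D X"] D_add)

text \<open>The derivative of the coefficient vanishes by \<open>vf_const\<close>. This serves the
  factor -1/2 in \<open>intrinsic_torsion\<close>.\<close>

lemma D_scale: "X \<in> \<X> \<Longrightarrow> Y \<in> \<X> \<Longrightarrow> D X (fmult (\<lambda>_. c) Y) = fmult (\<lambda>_. c) (D X Y)"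
  by (simp add: D_fmult smooth_const vf_const) (simp add: fmult_def fun_eq_iff)

lemma g_smooth: "X \<in> \<X> \<Longrightarrow> Y \<in> \<X> \<Longrightarrow> g X Y \<in> \<F>"
  and g_commute: "X \<in> \<X> \<Longrightarrow> Y \<in> \<X> \<Longrightarrow> g X Y = g Y X"
  and g_add_left: "X \<in> \<X> \<Longrightarrow> Y \<in> \<X> \<Longrightarrow> Z \<in> \<X> \<Longrightarrow> g (X + Y) Z = g X Z + g Y Z"
  and g_fmult_left: "f \<in> \<F> \<Longrightarrow> X \<in> \<X> \<Longrightarrow> Y \<in> \<X> \<Longrightarrow> g (fmult f X) Y = f * g X Y"
  and g_nonneg: "X \<in> \<X> \<Longrightarrow> 0 \<le> g X X p"
  and g_eq_0_iff: "X \<in> \<X> \<Longrightarrow> g X X p = 0 \<longleftrightarrow> vanishes_at A X p"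
  using hermitian unfolding almost_hermitian_manifold_def riemannian_metric_def by blast+

lemma g_add_right: "X \<in> \<X> \<Longrightarrow> Y \<in> \<X> \<Longrightarrow> Z \<in> \<X> \<Longrightarrow> g X (Y + Z) = g X Y + g X Z"
  using g_add_left[of Y Z X] g_commute[of X "Y + Z"] g_commute[of Y X] g_commute[of Z X] by simp

lemma g_fmult_right: "f \<in> \<F> \<Longrightarrow> X \<in> \<X> \<Longrightarrow> Y \<in> \<X> \<Longrightarrow> g X (fmult f Y) = f * g X Y"
  using g_fmult_left[of f Y X] g_commute[of X "fmult f Y"] g_commute[of X Y] by simp

lemma g_uminus_right: "X \<in> \<X> \<Longrightarrow> Y \<in> \<X> \<Longrightarrow> g X (- Y) = - g X Y"
  and g_diff_right: "X \<in> \<X> \<Longrightarrow> Y \<in> \<X> \<Longrightarrow> Z \<in> \<X> \<Longrightarrow> g X (Y - Z) = g X Y - g X Z"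
  and g_sum_right: "X \<in> \<X> \<Longrightarrow> (\<And>i. i \<in> I \<Longrightarrow> V i \<in> \<X>) \<Longrightarrow>
        g X (\<Sum>i\<in>I. V i) = (\<Sum>i\<in>I. g X (V i))"
  by (simp_all add: additive_vf(2-4)[of "g X"] g_add_right)

lemma g_diff_left: "X \<in> \<X> \<Longrightarrow> Y \<in> \<X> \<Longrightarrow> Z \<in> \<X> \<Longrightarrow> g (X - Y) Z = g X Z - g Y Z"
  using additive_vf(3)[of "\<lambda>X. g X Z"] g_add_left by simp

text \<open>An isometry with square -1 is skew: apply \<open>g_J_J\<close> to \<open>X\<close> and
  \<open>J Y\<close>.\<close>

lemma g_J_left:
  assumes "X \<in> \<X>" "Y \<in> \<X>"
  shows "g (J X) Y = - g X (J Y)"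
  using g_J_J[of X "J Y"] assms by (simp add: g_uminus_right minus_equation_iff)

text \<open>The metric axioms only relate vanishing at \<open>p\<close> to
  \<open>g V V p = 0\<close>. Testing against all \<open>W\<close> is equivalent because a null
  vector of a positive semidefinite form is orthogonal to everything.\<close>

lemma vanishes_at_iff:
  assumes V: "V \<in> \<X>"
  shows "vanishes_at A V p \<longleftrightarrow> (\<forall>W\<in>\<X>. g W V p = 0)"
proof
  assume "vanishes_at A V p"
  then have 0: "g V V p = 0"
    using g_eq_0_iff V by blast
  show "\<forall>W\<in>\<X>. g W V p = 0"
  proof (rule ballI, rule ccontr)
    fix W assume W: "W \<in> \<X>" and ne: "g W V p \<noteq> 0"
    \<comment> \<open>Since \<open>g V V p = 0\<close>, the square norm of \<open>W + t V\<close> at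
      \<open>p\<close> is affine in \<open>t\<close> with slope \<open>2 * g W V p\<close>; this
      \<open>t\<close> makes it -1.\<close>
    define t where "t = - (g W W p + 1) / (2 * g W V p)"
    let ?X = "W + fmult (\<lambda>_. t) V"
    have "g ?X ?X p = g W W p + 2 * t * g W V p"
      using V W 0 g_commute[OF V W]
      by (simp add: g_add_left g_add_right g_fmult_left g_fmult_right smooth_const)
    also have "\<dots> = - 1"
      using ne by (simp add: t_def field_simps)
    finally show False
      using g_nonneg[of ?X p] V W by (simp add: smooth_const)
  qed
next
  assume "\<forall>W\<in>\<X>. g W V p = 0"
  then show "vanishes_at A V p"
    using g_eq_0_iff V by blast
qed

section \<open>First and second derivatives of \<open>J\<close>, and the intrinsic torsion\<close>

lemma cov_endo_J_vf [simp]: "Y \<in> \<X> \<Longrightarrow> Z \<in> \<X> \<Longrightarrow> cov_endo D J Y Z \<in> \<X>"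
  by (simp add: cov_endo_def)

lemma cov_endo_J_add:
  "Y \<in> \<X> \<Longrightarrow> Z \<in> \<X> \<Longrightarrow> W \<in> \<X> \<Longrightarrow>
    cov_endo D J Y (Z + W) = cov_endo D J Y Z + cov_endo D J Y W"
  by (simp add: cov_endo_def J_add D_add)

lemma D_J: "Y \<in> \<X> \<Longrightarrow> Z \<in> \<X> \<Longrightarrow> D Y (J Z) = cov_endo D J Y Z + J (D Y Z)"
  by (simp add: cov_endo_def)

text \<open>This is the first derivative of J^2 = -1.\<close>

lemma cov_endo_J_J:
  "Y \<in> \<X> \<Longrightarrow> Z \<in> \<X> \<Longrightarrow> cov_endo D J Y (J Z) = - J (cov_endo D J Y Z)"
  by (simp add: cov_endo_def D_uminus J_diff)

text \<open>Derivatives of a skew endomorphism stay skew because the metric is parallel: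
  differentiate g(JZ, W) + g(Z, JW) = 0 along \<open>Y\<close> and cancel the terms where
  \<open>J\<close> itself is not differentiated.\<close>

lemma g_cov_endo_J_left:
  assumes "Y \<in> \<X>" "Z \<in> \<X>" "W \<in> \<X>"
  shows "g (cov_endo D J Y Z) W = - g Z (cov_endo D J Y W)"
proof -
  have "Y (g (J Z) W + g Z (J W)) = Y (g (J Z) W) + Y (g Z (J W))"
    using assms by (intro vf_apply_add g_smooth) simp_all
  moreover have "g (J Z) W + g Z (J W) = (\<lambda>_. 0)"
    using assms by (simp add: g_J_left zero_fun_def)
  ultimately have "Y (g (J Z) W) + Y (g Z (J W)) = 0"
    using vf_const[OF assms(1)] by metis
  then have *: "g (D Y (J Z)) W + g (J Z) (D Y W) + (g (D Y Z) (J W) + g Z (D Y (J W))) = 0"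
    by (simp only: D_metric assms J_vf)
  show ?thesis
  proof (rule ext)
    show "g (cov_endo D J Y Z) W p = (- g Z (cov_endo D J Y W)) p" for p
      using fun_cong[OF *, of p] assms
      by (simp add: cov_endo_def g_diff_left g_diff_right g_J_left)
  qed
qed

lemma cov2_endo_J_vf [simp]:
  "X \<in> \<X> \<Longrightarrow> Y \<in> \<X> \<Longrightarrow> Z \<in> \<X> \<Longrightarrow> cov2_endo D J X Y Z \<in> \<X>"
  unfolding cov2_endo_def cov_endo_def[of D "cov_endo D J Y"] by simp

text \<open>Differentiating \<open>cov_endo_J_J\<close> once more yields the two mixed products of
  first derivatives, one in each order.\<close>

lemma cov2_endo_J_J:
  assumes "X \<in> \<X>" "Y \<in> \<X>" "Z \<in> \<X>"
  shows "cov2_endo D J X Y (J Z) = - J (cov2_endo D J X Y Z)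
    - cov_endo D J X (cov_endo D J Y Z) - cov_endo D J Y (cov_endo D J X Z)"
  unfolding cov2_endo_def cov_endo_def[of D "cov_endo D J Y"]
  using assms by (simp add: cov_endo_J_J D_J D_uminus cov_endo_J_add J_diff J_add algebra_simps)

lemma cov_endo_form_intrinsic_torsion:
  assumes "X \<in> \<X>" "Z \<in> \<X>"
  shows "cov_endo_form D (intrinsic_torsion D J) X X Z
    = fmult (\<lambda>_. 1 / 4) (cov2_endo D J X X (J Z) - J (cov2_endo D J X X Z))"
proof -
  have "cov_endo_form D (intrinsic_torsion D J) X X Z
      = fmult (\<lambda>_. - 1 / 2) (cov_endo D J X (cov_endo D J X Z) + J (cov2_endo D J X X Z))"
    unfolding cov_endo_form_def intrinsic_torsion_def
      cov2_endo_def cov_endo_def[of D "cov_endo D J X"]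
    using assms by (simp add: D_scale D_J J_diff) (simp add: fmult_def fun_eq_iff algebra_simps)
  \<comment> \<open>Write N = \<open>cov_endo D J X\<close> and P =
    \<open>cov2_endo D J X X\<close>. With equal directions the mixed products coincide, so N^2 =
    -(P J + J P)/2; inserted into -(N^2 + J P)/2 this leaves (P J - J P)/4.\<close>
  then show ?thesis
    using assms by (simp add: cov2_endo_J_J fmult_def fun_eq_iff algebra_simps)
qed

text \<open>With a parallel metric only \<open>T\<close> gets differentiated. A general
  \<open>T\<close> allows two uses: first with \<open>J\<close>, then with
  \<open>cov_endo D J Y\<close>, which gives the second derivative of the Kaehler form.\<close>

lemma cov_form_g_right:
  assumes "\<And>Z W. Z \<in> \<X> \<Longrightarrow> W \<in> \<X> \<Longrightarrow> b Z W = g Z (T W)" "\<And>W. W \<in> \<X> \<Longrightarrow> T W \<in> \<X>"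
    and "X \<in> \<X>" "Z \<in> \<X>" "W \<in> \<X>"
  shows "cov_form D b X Z W = g Z (cov_endo D T X W)"
  using assms by (simp add: cov_form_def cov_endo_def D_metric g_diff_right) (simp add: fun_eq_iff)

lemma cov2_form_kahler_form:
  assumes "X \<in> \<X>" "Y \<in> \<X>" "Z \<in> \<X>" "W \<in> \<X>"
  shows "cov2_form D (kahler_form g J) X Y Z W = g Z (cov2_endo D J X Y W)"
proof -
  have 1: "cov_form D (kahler_form g J) V Z' W' = g Z' (cov_endo D J V W')"
    if "V \<in> \<X>" "Z' \<in> \<X>" "W' \<in> \<X>" for V Z' W'
    using that by (intro cov_form_g_right[where T = J]) (simp_all add: kahler_form_def)
  have "cov_form D (cov_form D (kahler_form g J) Y) X Z W = g Z (cov_endo D (cov_endo D J Y) X W)"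
    using assms 1 by (intro cov_form_g_right[where T = "cov_endo D J Y"]) simp_all
  moreover have "cov_endo D (cov_endo D J Y) X W \<in> \<X>"
    using assms unfolding cov_endo_def[of D "cov_endo D J Y"] by simp
  ultimately show ?thesis
    using assms by (simp add: cov2_form_def cov2_endo_def 1 g_diff_right)
qed

text \<open>The two factors -1/2 cancel the 4. Skewness moves one derivative of \<open>J\<close> to
  the other argument, and its anticommutation with \<open>J\<close> fixes the sign.\<close>

lemma kahler_form_intrinsic_torsion:
  assumes "V \<in> \<X>" "X \<in> \<X>" "Y \<in> \<X>"
  shows "4 * kahler_form g J (intrinsic_torsion D J V X) (intrinsic_torsion D J V Y) p
    = g X (J (cov_endo D J V (cov_endo D J V Y))) p"
  using assms unfolding kahler_form_def intrinsic_torsion_def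
  by (simp add: smooth_const J_fmult g_fmult_left g_fmult_right g_J_left g_uminus_right
      g_cov_endo_J_left cov_endo_J_J)

section \<open>Traces over a frame: Laplacians, codifferential and commutator\<close>

context
  fixes E :: "nat \<Rightarrow> 'm vfield"
  assumes E [simp]: "\<And>i. i < 2 * n \<Longrightarrow> E i \<in> \<X>"
begin

abbreviation "L \<equiv> rough_laplacian_endo (2 * n) E D J"
abbreviation "C \<equiv> commutator J L"

lemma rough_laplacian_J_vf [simp]: "Z \<in> \<X> \<Longrightarrow> L Z \<in> \<X>"
  unfolding rough_laplacian_endo_def by (intro vf_uminus vf_sum) simp

lemma rough_laplacian_J_sums:
  assumes "Z \<in> \<X>"
  shows "J (L Z) = - (\<Sum>i<2 * n. J (cov2_endo D J (E i) (E i) Z))"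
    and "X \<in> \<X> \<Longrightarrow> g X (L Z) = - (\<Sum>i<2 * n. g X (cov2_endo D J (E i) (E i) Z))"
proof -
  have V: "cov2_endo D J (E i) (E i) Z \<in> \<X>" if "i \<in> {..<2 * n}" for i
    using assms that by simp
  then have S: "(\<Sum>i<2 * n. cov2_endo D J (E i) (E i) Z) \<in> \<X>"
    by (rule vf_sum)
  show "J (L Z) = - (\<Sum>i<2 * n. J (cov2_endo D J (E i) (E i) Z))"
    unfolding rough_laplacian_endo_def J_uminus[OF S] by (subst J_sum) (use V in simp_all)
  show "g X (L Z) = - (\<Sum>i<2 * n. g X (cov2_endo D J (E i) (E i) Z))" if "X \<in> \<X>"
    unfolding rough_laplacian_endo_def g_uminus_right[OF that S]
    by (subst g_sum_right) (use V that in simp_all)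
qed

lemma commutator_J_vf [simp]: "Z \<in> \<X> \<Longrightarrow> C Z \<in> \<X>"
  by (simp add: commutator_def)

text \<open>Both \<open>codiff\<close> and \<open>L\<close> carry a minus sign, so tracing (P J - J
  P)/4 gives (L J - J L)/4.\<close>

lemma codiff_intrinsic_torsion:
  assumes "Z \<in> \<X>"
  shows "codiff (2 * n) E D (intrinsic_torsion D J) Z = fmult (\<lambda>_. - 1 / 4) (C Z)"
  using assms
  by (simp add: codiff_def commutator_def rough_laplacian_J_sums cov_endo_form_intrinsic_torsion)
    (simp add: rough_laplacian_endo_def fmult_def fun_eq_iff sum_fun_apply sum_subtractf
      flip: sum_divide_distrib)

lemma rough_laplacian_kahler_form:
  assumes "X \<in> \<X>" "Y \<in> \<X>"
  shows "rough_laplacian_form (2 * n) E D (kahler_form g J) X Y = g X (L Y)"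
  using assms
  by (simp add: rough_laplacian_form_def rough_laplacian_J_sums cov2_form_kahler_form)

text \<open>Pairing with \<open>J X\<close> exposes the failure to be Hermitian: by
  \<open>rough_laplacian_kahler_form\<close> the right side is the Laplacian of the Kaehler form at
  (X, Y) minus its value at (JX, JY).\<close>

lemma g_J_commutator:
  assumes "X \<in> \<X>" "Y \<in> \<X>"
  shows "g (J X) (C Y) = g X (L Y) - g (J X) (L (J Y))"
  using assms by (simp add: commutator_def g_diff_right g_J_J)

text \<open>Four times the torsion sum is minus the J-invariant part of the Laplacian of the Kaehler
  form. Adding it leaves the anti-invariant part, half of the difference in
  \<open>g_J_commutator\<close>.\<close>

lemma rough_laplacian_kahler_form_torsion:
  assumes "X \<in> \<X>" "Y \<in> \<X>"
  shows "rough_laplacian_form (2 * n) E D (kahler_form g J) X Y p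
      + 4 * (\<Sum>i<2 * n. kahler_form g J
          (intrinsic_torsion D J (E i) X) (intrinsic_torsion D J (E i) Y) p)
    = g (J X) (C Y) p / 2"
proof -
  let ?P = "\<lambda>i. cov2_endo D J (E i) (E i)"
  \<comment> \<open>Pairing \<open>cov2_endo_J_J\<close> with \<open>J X\<close> trades the square
    of the first derivative for second derivatives, which trace to \<open>L\<close>.\<close>
  have N: "2 * g X (J (cov_endo D J (E i) (cov_endo D J (E i) Y))) p
      = g X (?P i Y) p + g (J X) (?P i (J Y)) p" if "i < 2 * n" for i
  proof -
    let ?N = "cov_endo D J (E i) (cov_endo D J (E i) Y)"
    have "?P i (J Y) = - J (?P i Y) - ?N - ?N"
      using assms that by (intro cov2_endo_J_J) simp_all
    then have "g (J X) (?P i (J Y)) p = g (J X) (- J (?P i Y)) p - 2 * g (J X) ?N p"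
      using assms that by (simp only: g_diff_right vf_diff vf_uminus J_vf cov_endo_J_vf
          cov2_endo_J_vf E) simp
    then show ?thesis
      using assms that by (simp add: g_uminus_right g_J_J g_J_left[of X ?N])
  qed
  have "2 * (4 * (\<Sum>i<2 * n. kahler_form g J
          (intrinsic_torsion D J (E i) X) (intrinsic_torsion D J (E i) Y) p))
      = (\<Sum>i<2 * n. g X (?P i Y) p + g (J X) (?P i (J Y)) p)"
    unfolding sum_distrib_left
    by (rule sum.cong) (use assms N in \<open>simp_all add: kahler_form_intrinsic_torsion\<close>)
  also have "\<dots> = - g X (L Y) p - g (J X) (L (J Y)) p"
    using assms
    by (simp add: rough_laplacian_J_sums sum_fun_apply sum.distrib)
  finally show ?thesis
    using assms by (simp add: rough_laplacian_kahler_form g_J_commutator)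
qed

section \<open>The conditions expressed through vanishing of \<open>C\<close>\<close>

lemma vanishes_at_commutator_iff:
  assumes "Y \<in> \<X>"
  shows "vanishes_at A (C Y) p \<longleftrightarrow> (\<forall>X\<in>\<X>. g (J X) (C Y) p = 0)"
proof -
  \<comment> \<open>\<open>J\<close> is onto \<open>\<X>\<close>, so testing against all
    \<open>J X\<close> is as strong as testing against all fields.\<close>
  have "g W (C Y) p = g (J (- J W)) (C Y) p" if "W \<in> \<X>" for W
    using that by (simp add: J_uminus)
  then show ?thesis
    using assms unfolding vanishes_at_iff[OF commutator_J_vf[OF assms]]
    by (metis J_vf vf_uminus)
qed

lemma codiff_vanishes_iff:
  "(\<forall>Z\<in>\<X>. \<forall>p\<in>U. vanishes_at A (codiff (2 * n) E D (intrinsic_torsion D J) Z) p)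
    \<longleftrightarrow> (\<forall>Z\<in>\<X>. \<forall>p\<in>U. vanishes_at A (C Z) p)"
  by (simp add: codiff_intrinsic_torsion vanishes_at_def fmult_def)

lemma hermitian_rough_laplacian_iff:
  "hermitian_form_on A J U (rough_laplacian_form (2 * n) E D (kahler_form g J))
    \<longleftrightarrow> (\<forall>Z\<in>\<X>. \<forall>p\<in>U. vanishes_at A (C Z) p)"
proof -
  have "vanishes_at A (C Y) p \<longleftrightarrow> (\<forall>X\<in>\<X>. g (J X) (L (J Y)) p = g X (L Y) p)"
    if "Y \<in> \<X>" for Y p
    using that by (auto simp: vanishes_at_commutator_iff g_J_commutator)
  then show ?thesis
    unfolding hermitian_form_on_def by (auto simp: rough_laplacian_kahler_form)
qed

lemma rough_laplacian_torsion_iff: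
  "(\<forall>X\<in>\<X>. \<forall>Y\<in>\<X>. \<forall>p\<in>U. rough_laplacian_form (2 * n) E D (kahler_form g J) X Y p
      = - 4 * (\<Sum>i<2 * n. kahler_form g J
          (intrinsic_torsion D J (E i) X) (intrinsic_torsion D J (E i) Y) p))
    \<longleftrightarrow> (\<forall>Z\<in>\<X>. \<forall>p\<in>U. vanishes_at A (C Z) p)"
proof -
  have "rough_laplacian_form (2 * n) E D (kahler_form g J) X Y p
      = - 4 * (\<Sum>i<2 * n. kahler_form g J
          (intrinsic_torsion D J (E i) X) (intrinsic_torsion D J (E i) Y) p)
    \<longleftrightarrow> g (J X) (C Y) p = 0" if "X \<in> \<X>" "Y \<in> \<X>" for X Y p
    using rough_laplacian_kahler_form_torsion[OF that, of p] by linarith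
  then show ?thesis
    using vanishes_at_commutator_iff by (simp del: mult_minus_left) blast
qed

end

end

theorem theorem4p1:
  fixes A :: "('m::{t2_space, second_countable_topology}, 'e::euclidean_space) chart set"
    and n :: nat
    and g :: "'m vfield \<Rightarrow> 'm vfield \<Rightarrow> 'm \<Rightarrow> real"
    and J :: "'m vfield \<Rightarrow> 'm vfield"
    and D :: "'m vfield \<Rightarrow> 'm vfield \<Rightarrow> 'm vfield"
    and \<omega> :: "'m vfield \<Rightarrow> 'm vfield \<Rightarrow> 'm \<Rightarrow> real"
    and \<xi> :: "'m vfield \<Rightarrow> 'm vfield \<Rightarrow> 'm vfield"
  assumes "almost_hermitian_manifold n A g J"
    and "levi_civita_connection A g D"
    and "\<omega> = kahler_form g J"
    and "\<xi> = intrinsic_torsion D J"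
  shows
    "(harmonic_almost_hermitian n A g J D \<longleftrightarrow>
       (\<forall>U E. local_orthonormal_frame A g U E \<longrightarrow>
          (\<forall>Z\<in>vector_fields A. \<forall>p\<in>U.
             vanishes_at A (commutator J (rough_laplacian_endo (2 * n) E D J) Z) p))) \<and>
     (harmonic_almost_hermitian n A g J D \<longleftrightarrow>
       (\<forall>U E. local_orthonormal_frame A g U E \<longrightarrow>
          hermitian_form_on A J U (rough_laplacian_form (2 * n) E D \<omega>))) \<and>
     (harmonic_almost_hermitian n A g J D \<longleftrightarrow>
       (\<forall>U E. local_orthonormal_frame A g U E \<longrightarrow>
          (\<forall>X\<in>vector_fields A. \<forall>Y\<in>vector_fields A. \<forall>p\<in>U.
             rough_laplacian_form (2 * n) E D \<omega> X Y p
               = - 4 * (\<Sum>i<2 * n. \<omega> (\<xi> (E i) X) (\<xi> (E i) Y) p))))"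
proof -
  interpret almost_hermitian A n g J D
    using assms(1,2) by unfold_locales
  have "DIM('e) = 2 * n"
    using assms(1) by (simp add: almost_hermitian_manifold_def)
  \<comment> \<open>Frames are indexed up to \<open>DIM('e)\<close>, the traces up to
    \<open>2 * n\<close>.\<close>
  then have frame: "E i \<in> \<X>" if "local_orthonormal_frame A g U E" "i < 2 * n" for U E i
    using that by (simp add: local_orthonormal_frame_def)
  \<comment> \<open>For each fixed frame, harmonicity, the Hermitian condition and the torsion
    formula all reduce to vanishing of the commutator on \<open>U\<close>; quantifying over frames
    then gives the equivalences.\<close>
  have "(\<forall>Z\<in>\<X>. \<forall>p\<in>U. vanishes_at A (codiff (2 * n) E D \<xi> Z) p)
      \<longleftrightarrow> (\<forall>Z\<in>\<X>. \<forall>p\<in>U. vanishes_at A (commutator J (rough_laplacian_endo (2 * n) E D J) Z) p)"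
    if "local_orthonormal_frame A g U E" for U E
    unfolding assms(4) using frame[OF that] by (rule codiff_vanishes_iff)
  moreover have "hermitian_form_on A J U (rough_laplacian_form (2 * n) E D \<omega>)
      \<longleftrightarrow> (\<forall>Z\<in>\<X>. \<forall>p\<in>U. vanishes_at A (commutator J (rough_laplacian_endo (2 * n) E D J) Z) p)"
    if "local_orthonormal_frame A g U E" for U E
    unfolding assms(3) using frame[OF that] by (rule hermitian_rough_laplacian_iff)
  moreover have "(\<forall>X\<in>\<X>. \<forall>Y\<in>\<X>. \<forall>p\<in>U. rough_laplacian_form (2 * n) E D \<omega> X Y p
        = - 4 * (\<Sum>i<2 * n. \<omega> (\<xi> (E i) X) (\<xi> (E i) Y) p))
      \<longleftrightarrow> (\<forall>Z\<in>\<X>. \<forall>p\<in>U. vanishes_at A (commutator J (rough_laplacian_endo (2 * n) E D J) Z) p)"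
    if "local_orthonormal_frame A g U E" for U E
    unfolding assms(3,4) using frame[OF that] by (rule rough_laplacian_torsion_iff)
  ultimately show ?thesis
    unfolding harmonic_almost_hermitian_def assms(4)[symmetric] by simp
qed

end
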